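(* Let $n\ge 1$. The Hilbert transformation $H$ on $L^2(\mathbb{R}^n,\mathrm{Cl}_n)$ commutes with the natural representation $\pi$ of the group $\mathfrak{G}_n=r\mathrm{Spin}(n)+\mathbb{R}^n$: for all $(r,s,b)\in\mathfrak{G}_n$ and all $f\in L^2(\mathbb{R}^n,\mathrm{Cl}_n)$, $$H\big(\pi(r,s,b)f\big)=\pi(r,s,b)\big(Hf\big).$$
   Context: $\mathrm{Cl}_n$ is the Clifford algebra generated by $e_1,\dots,e_n$ with $e_j^2=-1$ and $e_je_k=-e_ke_j$ for $j\ne k$. A vector $x=(x_1,\dots,x_n)\in\mathbb{R}^n$ is identified with $\underline{x}=x_1e_1+\cdots+x_ne_n\in\mathrm{Cl}_n$. $L^2(\mathbb{R}^n,\mathrm{Cl}_n)$ is the space of square-integrable $\mathrm{Cl}_n$-valued functions. The Hilbert transformation is the principal value singular integral $Hf(\underline{x})=c_n\,\mathrm{p.v.}\!\int_{\mathbb{R}^n}\frac{\underline{x}-\underline{y}}{|\underline{x}-\underline{y}|^{n+1}}f(\underline{y})\,d\underline{y}$ (Clifford multiplication on the left by the kernel), with $c_n=\Gamma(\frac{n+1}{2})/\pi^{(n+1)/2}$, so that $H^2=I$. $\mathrm{Spin}(n)\subset\mathrm{Cl}_n$ is the group of products of an even number of unit vectors; for $s\in\mathrm{Spin}(n)$ and $\underline{x}\in\mathbb{R}^n$ one has $s\underline{x}s^{-1}\in\mathbb{R}^n$. The group $\mathfrak{G}_n=r\mathrm{Spin}(n)+\mathbb{R}^n$ consists of the triples $(r,s,b)$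 with $r>0$, $s\in\mathrm{Spin}(n)$, $b\in\mathbb{R}^n$, with product $(r,s,b)(r',s',b')=(rr',ss',rsb's^{-1}+b)$. Its natural unitary representation on $L^2(\mathbb{R}^n,\mathrm{Cl}_n)$ is $(\pi(r,s,b)f)(\underline{x})=r^{-n/2}\,s\,f\big(\tfrac1r s^{-1}(\underline{x}-b)s\big)$. *)

theory Defs
  imports "HOL-Analysis.Analysis" "HOL-Algebra.Group"
begin

section \<open>The real Clifford algebra with negative definite quadratic form\<close>

text \<open>
  Generators are indexed by a finite linearly ordered type \<open>'n\<close>, so that \<open>n = CARD('n)\<close>.  An element is
  given by its real coefficients with respect to the basis of blades \<open>e\<^sub>A\<close>, \<open>A\<close> a set of indices, where
  \<open>e\<^sub>A\<close> is the product of the \<open>e\<^sub>j\<close>, \<open>j \<in> A\<close>, in increasing order.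
\<close>

typedef 'n clifford = "UNIV :: (real, 'n::finite set) vec set"
  morphisms cl_coeffs Clifford ..

lemma cl_coeffs_Clifford [simp]: "cl_coeffs (Clifford v) = v"
  by (simp add: Clifford_inverse)

lemma Clifford_coeffs [simp]: "Clifford (cl_coeffs x) = x"
  by (rule cl_coeffs_inverse)

lemma clifford_eq_iff: "x = y \<longleftrightarrow> cl_coeffs x = cl_coeffs y"
  by (simp add: cl_coeffs_inject)

lemma clifford_eqI: "(\<And>A. cl_coeffs x $ A = cl_coeffs y $ A) \<Longrightarrow> x = y"
  by (simp add: clifford_eq_iff vec_eq_iff)

instantiation clifford :: (finite) real_vector
begin

definition zero_clifford :: "'a clifford" where "0 = Clifford 0"
definition plus_clifford :: "'a clifford \<Rightarrow> 'a clifford \<Rightarrow> 'a clifford" where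
  "x + y = Clifford (cl_coeffs x + cl_coeffs y)"
definition minus_clifford :: "'a clifford \<Rightarrow> 'a clifford \<Rightarrow> 'a clifford" where
  "x - y = Clifford (cl_coeffs x - cl_coeffs y)"
definition uminus_clifford :: "'a clifford \<Rightarrow> 'a clifford" where
  "- x = Clifford (- cl_coeffs x)"
definition scaleR_clifford :: "real \<Rightarrow> 'a clifford \<Rightarrow> 'a clifford" where
  "c *\<^sub>R x = Clifford (c *\<^sub>R cl_coeffs x)"

instance
  by standard
    (simp_all add: zero_clifford_def plus_clifford_def minus_clifford_def uminus_clifford_def
      scaleR_clifford_def clifford_eq_iff algebra_simps)

end

lemma cl_coeffs_zero [simp]: "cl_coeffs 0 = 0"
  and cl_coeffs_add [simp]: "cl_coeffs (x + y) = cl_coeffs x + cl_coeffs y"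
  and cl_coeffs_diff [simp]: "cl_coeffs (x - y) = cl_coeffs x - cl_coeffs y"
  and cl_coeffs_minus [simp]: "cl_coeffs (- x) = - cl_coeffs x"
  and cl_coeffs_scaleR [simp]: "cl_coeffs (c *\<^sub>R x) = c *\<^sub>R cl_coeffs x"
  by (simp_all add: zero_clifford_def plus_clifford_def minus_clifford_def uminus_clifford_def
      scaleR_clifford_def)

lemma cl_coeffs_sum [simp]: "cl_coeffs (sum f S) = (\<Sum>i\<in>S. cl_coeffs (f i))"
  by (induction S rule: infinite_finite_induct) auto

instantiation clifford :: (finite) real_inner
begin

definition inner_clifford :: "'a clifford \<Rightarrow> 'a clifford \<Rightarrow> real" where
  "x \<bullet> y = cl_coeffs x \<bullet> cl_coeffs y"
definition norm_clifford :: "'a clifford \<Rightarrow> real" where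
  "norm x = norm (cl_coeffs x)"
definition dist_clifford :: "'a clifford \<Rightarrow> 'a clifford \<Rightarrow> real" where
  "dist x y = norm (cl_coeffs x - cl_coeffs y)"
definition sgn_clifford :: "'a clifford \<Rightarrow> 'a clifford" where
  "sgn x = x /\<^sub>R norm (cl_coeffs x)"
definition uniformity_clifford :: "('a clifford \<times> 'a clifford) filter" where
  "uniformity = (INF e\<in>{0<..}. principal {(x :: 'a clifford, y). dist x y < e})"
definition open_clifford :: "'a clifford set \<Rightarrow> bool" where
  "open (U :: 'a clifford set) \<longleftrightarrow> (\<forall>x\<in>U. eventually (\<lambda>(x', y). x' = x \<longrightarrow> y \<in> U) uniformity)"

instance
proof
  fix x y z :: "'a clifford" and r :: real and U :: "'a clifford set"
  show "dist x y = norm (x - y)" "sgn x = x /\<^sub>R norm x" "norm x = sqrt (x \<bullet> x)"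
    by (simp_all add: dist_clifford_def norm_clifford_def sgn_clifford_def inner_clifford_def
        norm_eq_sqrt_inner)
  show "(uniformity :: ('a clifford \<times> 'a clifford) filter)
      = (INF e\<in>{0<..}. principal {(x, y). dist x y < e})"
    by (rule uniformity_clifford_def)
  show "open (U :: 'a clifford set) \<longleftrightarrow> (\<forall>x\<in>U. eventually (\<lambda>(x', y). x' = x \<longrightarrow> y \<in> U) uniformity)"
    by (rule open_clifford_def)
qed (simp_all add: inner_clifford_def inner_commute inner_add_right clifford_eq_iff)

end

instantiation clifford :: (finite) euclidean_space
begin

definition "Basis = Clifford ` Basis"

instance
proof
  show "(Basis :: 'a clifford set) \<noteq> {}" "finite (Basis :: 'a clifford set)"
    by (simp_all add: Basis_clifford_def)
next
  fix u v :: "'a clifford"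
  assume "u \<in> Basis" "v \<in> Basis"
  then show "u \<bullet> v = (if u = v then 1 else 0)"
    by (auto simp: Basis_clifford_def inner_clifford_def clifford_eq_iff inner_Basis)
next
  fix x :: "'a clifford"
  show "(\<forall>u\<in>Basis. x \<bullet> u = 0) \<longleftrightarrow> x = 0"
    by (simp add: Basis_clifford_def inner_clifford_def clifford_eq_iff
        euclidean_all_zero_iff)
qed

end

text \<open>
  \<open>blade_sign A B\<close> is the sign in \<open>e\<^sub>A e\<^sub>B = \<plusminus> e\<^sub>A\<^sub>\<triangle>\<^sub>B\<close>: one factor \<open>-1\<close> for each transposition needed to
  sort the generators (pairs \<open>b < a\<close>) and one for each square \<open>e\<^sub>a\<^sup>2 = -1\<close> (pairs \<open>b = a\<close>).
\<close>

definition blade_sign :: "'n::{finite,linorder} set \<Rightarrow> 'n set \<Rightarrow> real" where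
  "blade_sign A B = (-1) ^ card {(a, b). a \<in> A \<and> b \<in> B \<and> b \<le> a}"

definition blade :: "'n::finite set \<Rightarrow> 'n clifford" where
  "blade A = Clifford (axis A 1)"

lemma cl_coeffs_blade: "cl_coeffs (blade A) $ B = (if A = B then 1 else 0)"
  by (simp add: blade_def axis_def)

lemma blade_sign_prod:
  "blade_sign A B = (\<Prod>a\<in>A. \<Prod>b\<in>B. if b \<le> a then -1 else 1)"
proof -
  have "(\<Prod>a\<in>A. \<Prod>b\<in>B. if b \<le> a then -1 else 1 :: real)
      = (\<Prod>p\<in>A \<times> B. if snd p \<le> fst p then -1 else 1)"
    by (simp add: prod.cartesian_product split_def)
  also have "\<dots> = (\<Prod>p\<in>{p \<in> A \<times> B. snd p \<le> fst p}. -1)"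
    by (subst prod.inter_filter) auto
  also have "\<dots> = (-1) ^ card {p \<in> A \<times> B. snd p \<le> fst p}"
    by simp
  also have "{p \<in> A \<times> B. snd p \<le> fst p} = {(a, b). a \<in> A \<and> b \<in> B \<and> b \<le> a}"
    by auto
  finally show ?thesis
    by (simp add: blade_sign_def)
qed

lemma prod_sym_diff:
  fixes f :: "'a::finite \<Rightarrow> real"
  assumes "\<And>a. f a * f a = 1"
  shows "prod f (sym_diff A B) = prod f A * prod f B"
proof -
  have A: "prod f A = prod f (A - B) * prod f (A \<inter> B)"
    by (subst prod.union_disjoint [symmetric]) (auto intro: arg_cong [where f = "prod f"])
  have B: "prod f B = prod f (B - A) * prod f (A \<inter> B)"
    by (subst prod.union_disjoint [symmetric]) (auto intro: arg_cong [where f = "prod f"])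
  have "prod f (A \<inter> B) * prod f (A \<inter> B) = 1"
    by (simp add: prod.distrib [symmetric] assms)
  then have "prod f A * prod f B = prod f (A - B) * prod f (B - A)"
    unfolding A B by (simp add: algebra_simps)
  also have "\<dots> = prod f (sym_diff A B)"
    by (subst prod.union_disjoint) auto
  finally show ?thesis ..
qed

lemma blade_sign_sq: "blade_sign A B * blade_sign A B = 1"
  by (simp add: blade_sign_def flip: power_mult_distrib)

lemma blade_sign_left: "blade_sign (sym_diff A B) C = blade_sign A C * blade_sign B C"
  unfolding blade_sign_prod
  by (rule prod_sym_diff) (simp flip: prod.distrib add: if_distrib cong: if_cong)

lemma blade_sign_right: "blade_sign A (sym_diff B C) = blade_sign A B * blade_sign A C"
  unfolding blade_sign_prod
  by (subst prod_sym_diff) (auto simp: prod.distrib)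

lemma blade_sign_empty [simp]: "blade_sign {} B = 1" "blade_sign A {} = 1"
  by (simp_all add: blade_sign_prod)

lemma sym_diff_cancel [simp]: "sym_diff A (sym_diff A B) = B"
  by auto

lemma sum_sym_diff:
  fixes f :: "'a::finite set \<Rightarrow> 'b::comm_monoid_add"
  shows "(\<Sum>C\<in>UNIV. f C) = (\<Sum>B\<in>UNIV. f (sym_diff A B))"
  by (rule sum.reindex_bij_witness [where i = "sym_diff A" and j = "sym_diff A"])
    (simp_all only: sym_diff_cancel UNIV_I)

text \<open>
  In the product the coefficient of \<open>e\<^sub>C\<close> collects the pairs \<open>(A, B)\<close> with \<open>A \<triangle> B = C\<close>, that is, \<open>B = A \<triangle> C\<close>.
\<close>

instantiation clifford :: ("{finite,linorder}") real_algebra_1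
begin

definition one_clifford :: "'a clifford" where "1 = blade {}"

definition times_clifford :: "'a clifford \<Rightarrow> 'a clifford \<Rightarrow> 'a clifford" where
  "x * y = Clifford (\<chi> C. \<Sum>A\<in>UNIV.
     blade_sign A (sym_diff A C) * cl_coeffs x $ A * cl_coeffs y $ (sym_diff A C))"

instance
proof
  fix x y z :: "'a clifford" and c :: real
  show "x * y * z = x * (y * z)"
  proof (rule clifford_eqI)
    fix D
    let ?X = "\<lambda>A. cl_coeffs x $ A" and ?Y = "\<lambda>A. cl_coeffs y $ A" and ?Z = "\<lambda>A. cl_coeffs z $ A"
    let ?s = "\<lambda>A B. blade_sign A (B :: 'a set)"
    have "cl_coeffs (x * y * z) $ D =
        (\<Sum>C\<in>UNIV. \<Sum>A\<in>UNIV. ?s C (sym_diff C D) * (?s A (sym_diff A C) * ?X A *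
           ?Y (sym_diff A C)) * ?Z (sym_diff C D))"
      by (simp add: times_clifford_def sum_distrib_left sum_distrib_right)
    also have "\<dots> = (\<Sum>A\<in>UNIV. \<Sum>C\<in>UNIV. ?s C (sym_diff C D) * (?s A (sym_diff A C) * ?X A *
           ?Y (sym_diff A C)) * ?Z (sym_diff C D))"
      by (rule sum.swap)
    also have "\<dots> = (\<Sum>A\<in>UNIV. \<Sum>B\<in>UNIV. ?s (sym_diff A B) (sym_diff (sym_diff A B) D) *
           (?s A B * ?X A * ?Y B) * ?Z (sym_diff (sym_diff A B) D))"
    proof (rule sum.cong [OF refl])
      fix A :: "'a set"
      show "(\<Sum>C\<in>UNIV. ?s C (sym_diff C D) * (?s A (sym_diff A C) * ?X A *
             ?Y (sym_diff A C)) * ?Z (sym_diff C D)) =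
           (\<Sum>B\<in>UNIV. ?s (sym_diff A B) (sym_diff (sym_diff A B) D) *
             (?s A B * ?X A * ?Y B) * ?Z (sym_diff (sym_diff A B) D))"
        unfolding sum_sym_diff [where A = A and f = "\<lambda>C. ?s C (sym_diff C D) *
          (?s A (sym_diff A C) * ?X A * ?Y (sym_diff A C)) * ?Z (sym_diff C D)"]
        by (simp only: sym_diff_cancel)
    qed
    also have "\<dots> = (\<Sum>A\<in>UNIV. \<Sum>B\<in>UNIV. ?s A (sym_diff A D) * ?X A *
           (?s B (sym_diff B (sym_diff A D)) * ?Y B * ?Z (sym_diff B (sym_diff A D))))"
    proof (intro sum.cong refl)
      fix A B
      define E where "E = sym_diff B (sym_diff A D)"
      have E: "sym_diff (sym_diff A B) D = E" "sym_diff B (sym_diff A D) = E"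
        and A: "sym_diff A D = sym_diff B E"
        unfolding E_def by blast+
      show "?s (sym_diff A B) (sym_diff (sym_diff A B) D) *
           (?s A B * ?X A * ?Y B) * ?Z (sym_diff (sym_diff A B) D) =
         ?s A (sym_diff A D) * ?X A *
           (?s B (sym_diff B (sym_diff A D)) * ?Y B * ?Z (sym_diff B (sym_diff A D)))"
        unfolding E unfolding A blade_sign_left blade_sign_right by simp
    qed
    also have "\<dots> = cl_coeffs (x * (y * z)) $ D"
      by (simp add: times_clifford_def sum_distrib_left)
    finally show "cl_coeffs (x * y * z) $ D = cl_coeffs (x * (y * z)) $ D" .
  qed
  show "1 * x = x"
    by (rule clifford_eqI)
      (simp add: times_clifford_def one_clifford_def cl_coeffs_blade if_distrib if_distribR
        cong: if_cong)
  show "x * 1 = x"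
  proof (rule clifford_eqI)
    fix C
    have "{} = sym_diff A C \<longleftrightarrow> A = C" for A :: "'a set"
      by auto
    then show "cl_coeffs (x * 1) $ C = cl_coeffs x $ C"
      by (simp add: times_clifford_def one_clifford_def cl_coeffs_blade if_distrib if_distribR
          cong: if_cong)
  qed
  show "(x + y) * z = x * z + y * z" "x * (y + z) = x * y + x * z"
    by (rule clifford_eqI; simp add: times_clifford_def algebra_simps sum.distrib)+
  show "c *\<^sub>R x * y = c *\<^sub>R (x * y)" "x * c *\<^sub>R y = c *\<^sub>R (x * y)"
    by (rule clifford_eqI; simp add: times_clifford_def algebra_simps sum_distrib_left)+
  show "(0 :: 'a clifford) \<noteq> 1"
    by (auto simp: one_clifford_def cl_coeffs_blade clifford_eq_iff vec_eq_iff)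
qed

end

lemma blade_mult: "blade A * blade B = blade_sign A B *\<^sub>R blade (sym_diff A B)"
proof (rule clifford_eqI)
  fix C
  define E where "E = sym_diff A C"
  have E: "B = E \<longleftrightarrow> sym_diff A B = C"
    unfolding E_def by blast
  have "cl_coeffs (blade A * blade B) $ C =
      (\<Sum>A'\<in>UNIV. if A' = A then blade_sign A E * (if B = E then 1 else 0) else 0)"
    unfolding times_clifford_def cl_coeffs_Clifford vec_lambda_beta cl_coeffs_blade E_def
    by (rule sum.cong) simp_all
  also have "\<dots> = blade_sign A E * (if B = E then 1 else 0)"
    by (simp only: sum.delta finite UNIV_I if_True)
  also have "\<dots> = blade_sign A B * (if sym_diff A B = C then 1 else 0)"
    unfolding E [symmetric] by (cases "B = E") simp_all
  also have "\<dots> = cl_coeffs (blade_sign A B *\<^sub>R blade (sym_diff A B)) $ C"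
    by (simp only: cl_coeffs_scaleR vector_scaleR_component cl_coeffs_blade real_scaleR_def)
  finally show "cl_coeffs (blade A * blade B) $ C =
      cl_coeffs (blade_sign A B *\<^sub>R blade (sym_diff A B)) $ C" .
qed

lemma generator_sq: "blade {j} * blade {j} = - 1"
  by (simp add: blade_mult blade_sign_prod one_clifford_def)

lemma generator_anticommute: "j \<noteq> k \<Longrightarrow> blade {j} * blade {k} = - (blade {k} * blade {j})"
  by (auto simp: blade_mult blade_sign_prod insert_commute Un_commute)


section \<open>Vectors, inverses and the spin group\<close>

definition cvec :: "real ^ 'n \<Rightarrow> 'n::finite clifford" where
  "cvec x = (\<Sum>j\<in>UNIV. x $ j *\<^sub>R blade {j})"

text \<open>
  The projection onto the span of the generators, read back as a vector.  It is used below only on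
  elements in the range of \<open>cvec\<close> (lemma \<open>cvec_vec_part_spin\<close>), where it inverts \<open>cvec\<close>.
\<close>

definition vec_part :: "'n::finite clifford \<Rightarrow> real ^ 'n" where
  "vec_part a = (\<chi> j. cl_coeffs a $ {j})"

lemma vec_part_cvec [simp]: "vec_part (cvec x) = x"
  by (simp add: vec_part_def cvec_def vec_eq_iff cl_coeffs_blade if_distrib cong: if_cong)

definition clifford_inv :: "'n::{finite,linorder} clifford \<Rightarrow> 'n clifford" where
  "clifford_inv a = (THE b. a * b = 1 \<and> b * a = 1)"

lemma clifford_inv_eq:
  assumes "a * b = 1" "b * a = 1"
  shows "clifford_inv a = b"
  unfolding clifford_inv_def
proof (rule the_equality)
  fix c assume c: "a * c = 1 \<and> c * a = 1"
  have "c = b * a * c"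
    by (simp add: assms)
  also have "\<dots> = b"
    using c by (simp add: mult.assoc)
  finally show "c = b" .
qed (use assms in simp)

definition Spin :: "'n::{finite,linorder} clifford set" where
  "Spin = {prod_list (map cvec us) | us. even (length us) \<and> (\<forall>u\<in>set us. norm u = 1)}"

lemma cvec_add: "cvec (x + y) = cvec x + cvec y"
  and cvec_diff: "cvec (x - y) = cvec x - cvec y"
  and cvec_scaleR: "cvec (c *\<^sub>R x) = c *\<^sub>R cvec x"
  by (simp_all add: cvec_def algebra_simps sum.distrib sum_subtractf scaleR_sum_right)

lemma cvec_anticommute: "cvec x * cvec y + cvec y * cvec x = (- 2 * (x \<bullet> y)) *\<^sub>R 1"
proof -
  have gen: "blade {j} * blade {k} + blade {k} * blade {j} = (if j = k then - 2 *\<^sub>R 1 else 0)"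
    for j k :: 'a
  proof (cases "j = k")
    case True
    have "- 2 *\<^sub>R (1 :: 'a clifford) = - 1 + - 1"
      by (simp add: scaleR_2 del: one_add_one)
    then show ?thesis
      using True by (simp only: generator_sq refl if_True)
  next
    case False
    then show ?thesis
      by (simp only: generator_anticommute [OF False] if_False left_minus)
  qed
  have 1: "cvec x * cvec y = (\<Sum>j\<in>UNIV. \<Sum>k\<in>UNIV. (x $ j * y $ k) *\<^sub>R (blade {j} * blade {k}))"
    by (simp only: cvec_def sum_product mult_scaleR_left mult_scaleR_right scaleR_scaleR
        mult.commute [of "y $ _"])
  have 2: "cvec y * cvec x = (\<Sum>j\<in>UNIV. \<Sum>k\<in>UNIV. (x $ j * y $ k) *\<^sub>R (blade {k} * blade {j}))"
    unfolding cvec_def sum_product mult_scaleR_left mult_scaleR_right scaleR_scaleR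
    by (subst sum.swap) (simp only: mult.commute)
  have "cvec x * cvec y + cvec y * cvec x =
      (\<Sum>j\<in>UNIV. \<Sum>k\<in>UNIV. (x $ j * y $ k) *\<^sub>R (if j = k then - 2 *\<^sub>R 1 else 0))"
    unfolding 1 2 by (simp only: sum.distrib [symmetric] scaleR_add_right [symmetric] gen)
  also have "\<dots> = (- 2 * (x \<bullet> y)) *\<^sub>R 1"
    by (simp add: if_distrib inner_vec_def sum_distrib_left scaleR_sum_left sum_negf
        mult.commute cong: if_cong)
  finally show ?thesis .
qed

lemma cvec_sq: "cvec x * cvec x = (- (x \<bullet> x)) *\<^sub>R 1"
proof -
  have "(1 / 2) *\<^sub>R (cvec x * cvec x + cvec x * cvec x) = (1 / 2) *\<^sub>R ((- 2 * (x \<bullet> x)) *\<^sub>R 1)"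
    by (simp only: cvec_anticommute)
  then show ?thesis
    by (simp flip: scaleR_2)
qed

lemma cvec_reflect:
  assumes "norm u = 1"
  shows "cvec u * cvec x * cvec u = cvec (x - (2 * (u \<bullet> x)) *\<^sub>R u)"
proof -
  have "cvec u * cvec x = (- 2 * (u \<bullet> x)) *\<^sub>R 1 - cvec x * cvec u"
    using cvec_anticommute [of u x] by (simp add: algebra_simps)
  then have "cvec u * cvec x * cvec u = (- 2 * (u \<bullet> x)) *\<^sub>R cvec u - cvec x * (cvec u * cvec u)"
    by (simp add: left_diff_distrib mult.assoc)
  also have "cvec u * cvec u = - 1"
    using assms by (simp add: cvec_sq dot_square_norm)
  finally show ?thesis
    by (simp add: cvec_diff cvec_scaleR)
qed

lemma unit_vectors_prod:
  assumes "\<forall>u\<in>set us. norm u = 1"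
  defines "s \<equiv> prod_list (map cvec us)"
  obtains t where "s * t = 1" "t * s = 1" "t = prod_list (map cvec (rev (map uminus us)))"
    "\<And>x. \<exists>y. s * cvec x * t = cvec y"
proof -
  have "s * prod_list (map cvec (rev (map uminus us))) = 1
      \<and> prod_list (map cvec (rev (map uminus us))) * s = 1
      \<and> (\<forall>x. \<exists>y. s * cvec x * prod_list (map cvec (rev (map uminus us))) = cvec y)"
    using assms(1) unfolding s_def
  proof (induction us)
    case Nil
    then show ?case by auto
  next
    case (Cons u us)
    let ?s = "prod_list (map cvec us)" and ?t = "prod_list (map cvec (rev (map uminus us)))"
    have IH: "?s * ?t = 1" "?t * ?s = 1" "\<And>x. \<exists>y. ?s * cvec x * ?t = cvec y"
      using Cons by auto
    have u: "norm u = 1"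
      using Cons.prems by simp
    have neg: "cvec (- u) = - cvec u"
      using cvec_scaleR [of "-1" u] by simp
    have sq: "cvec u * cvec u = - 1"
      using u by (simp add: cvec_sq dot_square_norm)
    have "cvec u * ?s * (?t * cvec (- u)) = cvec u * (?s * ?t) * cvec (- u)"
      by (simp add: mult.assoc)
    then have 1: "cvec u * ?s * (?t * cvec (- u)) = 1"
      by (simp add: IH neg sq)
    have "?t * cvec (- u) * (cvec u * ?s) = ?t * (cvec (- u) * cvec u) * ?s"
      by (simp add: mult.assoc)
    then have 2: "?t * cvec (- u) * (cvec u * ?s) = 1"
      by (simp add: IH neg sq)
    have 3: "\<exists>y. cvec u * ?s * cvec x * (?t * cvec (- u)) = cvec y" for x
    proof -
      obtain y where y: "?s * cvec x * ?t = cvec y"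
        using IH(3) by blast
      have "cvec u * ?s * cvec x * (?t * cvec (- u)) = cvec u * (?s * cvec x * ?t) * cvec (- u)"
        by (simp add: mult.assoc)
      also have "\<dots> = cvec ((-1) *\<^sub>R (y - (2 * (u \<bullet> y)) *\<^sub>R u))"
        unfolding y neg cvec_scaleR by (simp add: cvec_reflect u)
      finally show ?thesis by blast
    qed
    show ?case
      using 1 2 3 by simp
  qed
  with that show ?thesis by blast
qed

lemma Spin_inv:
  assumes "s \<in> Spin"
  shows "s * clifford_inv s = 1" "clifford_inv s * s = 1" "clifford_inv s \<in> Spin"
    and "\<exists>y. s * cvec x * clifford_inv s = cvec y"
proof -
  obtain us where us: "s = prod_list (map cvec us)" "even (length us)" "\<forall>u\<in>set us. norm u = 1"
    using assms by (auto simp: Spin_def)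
  obtain t where t: "s * t = 1" "t * s = 1" "t = prod_list (map cvec (rev (map uminus us)))"
    and y: "\<And>x. \<exists>y. s * cvec x * t = cvec y"
    using unit_vectors_prod [OF us(3)] us(1) by metis
  have inv: "clifford_inv s = t"
    using t by (intro clifford_inv_eq)
  show "s * clifford_inv s = 1" "clifford_inv s * s = 1"
    "\<exists>y. s * cvec x * clifford_inv s = cvec y"
    using t y by (simp_all add: inv)
  show "clifford_inv s \<in> Spin"
    unfolding inv t(3) Spin_def
    by (rule CollectI, rule exI [of _ "rev (map uminus us)"]) (use us in simp)
qed

lemma cvec_vec_part_spin:
  assumes "s \<in> Spin"
  shows "cvec (vec_part (s * cvec x * clifford_inv s)) = s * cvec x * clifford_inv s"
  using Spin_inv(4) [OF assms, of x] by auto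

lemma one_Spin: "1 \<in> Spin"
  unfolding Spin_def by (rule CollectI, rule exI [of _ "[]"]) simp

lemma mult_Spin:
  assumes "s \<in> Spin" "t \<in> Spin"
  shows "s * t \<in> Spin"
proof -
  obtain us where us: "s = prod_list (map cvec us)" "even (length us)" "\<forall>u\<in>set us. norm u = 1"
    using assms(1) by (auto simp: Spin_def)
  obtain vs where vs: "t = prod_list (map cvec vs)" "even (length vs)" "\<forall>u\<in>set vs. norm u = 1"
    using assms(2) by (auto simp: Spin_def)
  show ?thesis
    unfolding Spin_def
    by (rule CollectI, rule exI [of _ "us @ vs"]) (use us vs in auto)
qed


section \<open>The group and its representation\<close>

definition rspin_group :: "(real \<times> 'n::{finite,linorder} clifford \<times> (real, 'n) vec) monoid" where
  "rspin_group = \<lparr>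
     carrier = {0<..} \<times> Spin \<times> UNIV,
     mult = (\<lambda>(r, s, b) (r', s', b').
       (r * r', s * s', vec_part (r *\<^sub>R (s * cvec b' * clifford_inv s)) + b)),
     one = (1, 1, 0)\<rparr>"

lemma clifford_inv_mult:
  assumes "s \<in> Spin" "t \<in> Spin"
  shows "clifford_inv (s * t) = clifford_inv t * clifford_inv s"
proof (rule clifford_inv_eq)
  have "s * t * (clifford_inv t * clifford_inv s) = s * (t * clifford_inv t) * clifford_inv s"
    by (simp add: mult.assoc)
  then show "s * t * (clifford_inv t * clifford_inv s) = 1"
    by (simp add: Spin_inv assms)
  have "clifford_inv t * clifford_inv s * (s * t) = clifford_inv t * (clifford_inv s * s) * t"
    by (simp add: mult.assoc)
  then show "clifford_inv t * clifford_inv s * (s * t) = 1"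
    by (simp add: Spin_inv assms)
qed

lemma clifford_inv_inv: "s \<in> Spin \<Longrightarrow> clifford_inv (clifford_inv s) = s"
  by (rule clifford_inv_eq) (simp_all add: Spin_inv)

lemma clifford_inv_one: "clifford_inv 1 = 1"
  by (rule clifford_inv_eq) simp_all

lemma vec_part_add: "vec_part (x + y) = vec_part x + vec_part y"
  and vec_part_scaleR: "vec_part (c *\<^sub>R x) = c *\<^sub>R vec_part x"
  by (simp_all add: vec_part_def vec_eq_iff)

lemma group_rspin_group: "group rspin_group"
proof (rule groupI)
  fix x y z :: "real \<times> 'a clifford \<times> (real, 'a) vec"
  assume "x \<in> carrier rspin_group" "y \<in> carrier rspin_group" "z \<in> carrier rspin_group"
  moreover obtain r s b r' s' b' r'' s'' b''
    where xyz: "x = (r, s, b)" "y = (r', s', b')" "z = (r'', s'', b'')"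
    by (metis prod_cases3)
  ultimately have s: "s \<in> Spin" "s' \<in> Spin" "s'' \<in> Spin"
    by (simp_all add: rspin_group_def)
  let ?c = "\<lambda>s b. s * cvec b * clifford_inv s"
  have 1: "cvec (vec_part (?c s' b'')) = ?c s' b''"
    by (rule cvec_vec_part_spin) (rule s)
  have 2: "?c (s * s') b'' = ?c s (vec_part (?c s' b''))"
    unfolding 1 clifford_inv_mult [OF s(1,2)] by (simp only: mult.assoc)
  have 3: "?c s (vec_part (r' *\<^sub>R ?c s' b'') + b') = r' *\<^sub>R ?c (s * s') b'' + ?c s b'"
    unfolding 2 by (simp only: vec_part_scaleR cvec_add cvec_scaleR distrib_left distrib_right
        mult_scaleR_left mult_scaleR_right)
  have "vec_part ((r * r') *\<^sub>R ?c (s * s') b'') + (vec_part (r *\<^sub>R ?c s b') + b) =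
      vec_part (r *\<^sub>R ?c s (vec_part (r' *\<^sub>R ?c s' b'') + b')) + b"
    unfolding 3 by (simp only: vec_part_scaleR vec_part_add scaleR_add_right scaleR_scaleR add.assoc)
  then show "x \<otimes>\<^bsub>rspin_group\<^esub> y \<otimes>\<^bsub>rspin_group\<^esub> z = x \<otimes>\<^bsub>rspin_group\<^esub> (y \<otimes>\<^bsub>rspin_group\<^esub> z)"
    by (simp add: xyz rspin_group_def mult.assoc [of r] mult.assoc [of s] add.assoc)
next
  fix x y :: "real \<times> 'a clifford \<times> (real, 'a) vec"
  assume "x \<in> carrier rspin_group" "y \<in> carrier rspin_group"
  then show "x \<otimes>\<^bsub>rspin_group\<^esub> y \<in> carrier rspin_group"
    by (auto simp: rspin_group_def mult_Spin)
next
  show "\<one>\<^bsub>rspin_group\<^esub> \<in> carrier rspin_group"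
    by (simp add: rspin_group_def one_Spin)
next
  fix x :: "real \<times> 'a clifford \<times> (real, 'a) vec"
  assume "x \<in> carrier rspin_group"
  then show "\<one>\<^bsub>rspin_group\<^esub> \<otimes>\<^bsub>rspin_group\<^esub> x = x"
    by (auto simp: rspin_group_def clifford_inv_one)
next
  fix x :: "real \<times> 'a clifford \<times> (real, 'a) vec"
  assume x: "x \<in> carrier rspin_group"
  obtain r s b where rsb: "x = (r, s, b)"
    by (metis prod_cases3)
  with x have r: "r > 0" and s: "s \<in> Spin"
    by (simp_all add: rspin_group_def)
  let ?t = "clifford_inv s"
  let ?y = "(1 / r, ?t, - vec_part ((1 / r) *\<^sub>R (?t * cvec b * clifford_inv ?t)))"
  have "?y \<in> carrier rspin_group" "?y \<otimes>\<^bsub>rspin_group\<^esub> x = \<one>\<^bsub>rspin_group\<^esub>"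
    using r s by (simp_all add: rsb rspin_group_def Spin_inv)
  then show "\<exists>y\<in>carrier rspin_group. y \<otimes>\<^bsub>rspin_group\<^esub> x = \<one>\<^bsub>rspin_group\<^esub>"
    by blast
qed

definition rspin_rep ::
    "real \<times> 'n::{finite,linorder} clifford \<times> (real, 'n) vec \<Rightarrow>
     ((real, 'n) vec \<Rightarrow> 'n clifford) \<Rightarrow> (real, 'n) vec \<Rightarrow> 'n clifford" where
  "rspin_rep = (\<lambda>(r, s, b) f x.
     r powr (- real CARD('n) / 2) *\<^sub>R
       (s * f (vec_part ((1 / r) *\<^sub>R (clifford_inv s * cvec (x - b) * s)))))"


section \<open>The Hilbert transformation\<close>

text \<open>Representatives of classes; equality in the space is equality almost everywhere.\<close>

definition L2 :: "('a::euclidean_space \<Rightarrow> 'b::euclidean_space) set" where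
  "L2 = {f \<in> borel_measurable lebesgue. integrable lebesgue (\<lambda>x. (norm (f x))\<^sup>2)}"

definition hilbert_kernel :: "(real, 'n) vec \<Rightarrow> 'n::{finite,linorder} clifford" where
  "hilbert_kernel z = (1 / norm z ^ (CARD('n) + 1)) *\<^sub>R cvec z"

text \<open>
  The integral is absolutely convergent for \<open>f \<in> L2\<close> and \<open>\<epsilon> > 0\<close>, by Cauchy-Schwarz.
\<close>

definition truncated_hilbert ::
    "real \<Rightarrow> ((real, 'n) vec \<Rightarrow> 'n::{finite,linorder} clifford) \<Rightarrow> (real, 'n) vec \<Rightarrow> 'n clifford" where
  "truncated_hilbert \<epsilon> f x =
     (LINT y:{y. \<epsilon> < norm (x - y)}|lebesgue. hilbert_kernel (x - y) * f y)"

definition hilbert_const :: "nat \<Rightarrow> real" where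
  "hilbert_const n = Gamma ((real n + 1) / 2) / pi powr ((real n + 1) / 2)"

text \<open>
  The principal value of a square-integrable function exists at almost every point; at the
  remaining points the value is set to \<open>0\<close>.
\<close>

definition hilbert ::
    "((real, 'n) vec \<Rightarrow> 'n::{finite,linorder} clifford) \<Rightarrow> (real, 'n) vec \<Rightarrow> 'n clifford" where
  "hilbert f x =
     (if \<exists>l. ((\<lambda>\<epsilon>. truncated_hilbert \<epsilon> f x) \<longlongrightarrow> l) (at_right 0)
      then hilbert_const CARD('n) *\<^sub>R Lim (at_right 0) (\<lambda>\<epsilon>. truncated_hilbert \<epsilon> f x)
      else 0)"

end

theory Submission
  imports Defs
begin

text \<open>
  Conjugation by \<open>s\<^sup>-\<^sup>1\<close> is an orthogonal map \<open>R\<close>, so \<open>y \<mapsto> R (y - b) / r\<close> scales volume by \<open>r\<^sup>-\<^sup>n\<close> and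
  distances by \<open>1 / r\<close>.  The kernel \<open>k\<close> satisfies \<open>k z s = r\<^sup>-\<^sup>n s k (R z / r)\<close>: the homogeneity factor
  cancels the Jacobian and \<open>s\<close> moves out to the left.  Hence the integral truncated at \<open>\<epsilon>\<close> of the
  transformed function is the transform of the integral truncated at \<open>\<epsilon> / r\<close>.  As left multiplication
  by \<open>s\<close> is invertible, one principal value exists exactly when the other does, and the identity holds
  at every point, also where no principal value exists and \<open>hilbert\<close> takes its default value \<open>0\<close>.
\<close>

section \<open>Lebesgue measure under similarities\<close>

lemma nn_integral_lborel_translate:
  fixes c :: "'a::euclidean_space"
  assumes [measurable]: "f \<in> borel_measurable borel"
  shows "(\<integral>\<^sup>+x. f (c + x) \<partial>lborel) = (\<integral>\<^sup>+x. f x \<partial>lborel)"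
proof -
  have "(\<integral>\<^sup>+x. f x \<partial>distr lborel borel ((+) c)) = (\<integral>\<^sup>+x. f (c + x) \<partial>lborel)"
    by (rule nn_integral_distr) auto
  then show ?thesis
    by (simp add: lborel_distr_plus)
qed

lemma orthogonal_transformation_measurable:
  fixes T :: "'a::euclidean_space \<Rightarrow> 'a"
  assumes "orthogonal_transformation T"
  shows "T \<in> borel_measurable borel"
  using assms by (intro borel_measurable_continuous_onI linear_continuous_on)
    (simp add: orthogonal_transformation linear_conv_bounded_linear)

text \<open>
  The uniqueness argument for Haar measure: the measure transported by an orthogonal map is invariant
  under translations, hence a multiple of Lebesgue measure, and the factor is read off on the unit ball.
\<close>

lemma emeasure_lborel_orthogonal_vimage:
  fixes T :: "'a::euclidean_space \<Rightarrow> 'a"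
  assumes T: "orthogonal_transformation T" and A [measurable]: "A \<in> sets borel"
  shows "emeasure lborel (T -` A) = emeasure lborel A"
proof -
  let ?B = "ball (0 :: 'a) 1"
  have [measurable]: "T \<in> borel_measurable borel"
    by (rule orthogonal_transformation_measurable [OF T])
  have [measurable]: "?B \<in> sets borel"
    by simp
  have vimage [measurable]: "T -` A \<in> sets borel"
    using measurable_sets [OF \<open>T \<in> borel_measurable borel\<close> A] by simp
  have add: "T (x + y) = T x + T y" for x y
    using T by (simp add: orthogonal_transformation linear_add)
  have norm: "norm (T x) = norm x" for x
    by (rule orthogonal_transformation_norm [OF T])
  have surj: "surj T"
    by (rule orthogonal_transformation_surj [OF T])
  \<comment> \<open>The unit ball is invariant under isometries and under negation, so it absorbs
    the \<open>- T x\<close> that the substitution below leaves.\<close>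
  have ball: "indicator ?B (- T x) = (indicator ?B x :: ennreal)" for x
    by (simp add: indicator_def norm)
  \<comment> \<open>The double integral of
    \<open>indicator A (T x) * indicator ?B (- T x + y)\<close> is computed in two ways: integrating
    over y first gives the left side; shifting x first and then integrating over y gives the right
    side.\<close>
  have "emeasure lborel (T -` A) * emeasure lborel ?B
      = (\<integral>\<^sup>+x. indicator A (T x) * (\<integral>\<^sup>+y. indicator ?B y \<partial>lborel) \<partial>lborel)"
    by (simp add: nn_integral_multc flip: indicator_vimage)
  also have "\<dots> = (\<integral>\<^sup>+x. indicator A (T x) * (\<integral>\<^sup>+y. indicator ?B (- T x + y) \<partial>lborel) \<partial>lborel)"
    by (subst nn_integral_lborel_translate) (rule borel_measurable_indicator, auto)
  also have "\<dots> = (\<integral>\<^sup>+x. (\<integral>\<^sup>+y. indicator A (T x) * indicator ?B (- T x + y) \<partial>lborel) \<partial>lborel)"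
    by (intro nn_integral_cong nn_integral_cmult [symmetric]) measurable
  also have "\<dots> = (\<integral>\<^sup>+y. (\<integral>\<^sup>+x. indicator A (T x) * indicator ?B (- T x + y) \<partial>lborel) \<partial>lborel)"
    by (rule lborel_pair.Fubini') measurable
  also have "\<dots> = (\<integral>\<^sup>+y. (\<integral>\<^sup>+x. indicator A (y + T x) * indicator ?B x \<partial>lborel) \<partial>lborel)"
  proof (rule nn_integral_cong)
    fix y
    \<comment> \<open>Shifting x by a preimage of y replaces \<open>T x\<close> by
      \<open>y + T x\<close>: y moves into the first factor and cancels in the second.\<close>
    obtain z where z: "T z = y"
      using surj by (metis surjD)
    have "(\<integral>\<^sup>+x. indicator A (T x) * indicator ?B (- T x + y) \<partial>lborel)
        = (\<integral>\<^sup>+x. indicator A (T (z + x)) * indicator ?B (- T (z + x) + y) \<partial>lborel)"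
      by (rule nn_integral_lborel_translate [symmetric]) measurable
    also have "\<dots> = (\<integral>\<^sup>+x. indicator A (y + T x) * indicator ?B x \<partial>lborel)"
      by (rule nn_integral_cong) (simp add: add z ball)
    finally show "(\<integral>\<^sup>+x. indicator A (T x) * indicator ?B (- T x + y) \<partial>lborel)
        = (\<integral>\<^sup>+x. indicator A (y + T x) * indicator ?B x \<partial>lborel)" .
  qed
  also have "\<dots> = (\<integral>\<^sup>+x. (\<integral>\<^sup>+y. indicator A (y + T x) * indicator ?B x \<partial>lborel) \<partial>lborel)"
    by (rule lborel_pair.Fubini') measurable
  also have "\<dots> = (\<integral>\<^sup>+x. (\<integral>\<^sup>+y. indicator A y \<partial>lborel) * indicator ?B x \<partial>lborel)"
  proof (rule nn_integral_cong)
    fix x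
    have "(\<integral>\<^sup>+y. indicator A (y + T x) * indicator ?B x \<partial>lborel)
        = (\<integral>\<^sup>+y. indicator A (T x + y) \<partial>lborel) * indicator ?B x"
      by (simp add: nn_integral_multc add.commute)
    then show "(\<integral>\<^sup>+y. indicator A (y + T x) * indicator ?B x \<partial>lborel)
        = (\<integral>\<^sup>+y. indicator A y \<partial>lborel) * indicator ?B x"
      by (subst (asm) nn_integral_lborel_translate) simp_all
  qed
  also have "\<dots> = emeasure lborel A * emeasure lborel ?B"
    by (simp add: nn_integral_cmult)
  finally have "emeasure lborel (T -` A) * emeasure lborel ?B = emeasure lborel A * emeasure lborel ?B" .
  moreover have "emeasure lborel ?B \<noteq> 0"
    using content_ball_pos [of 1 "0 :: 'a"] by (auto simp: measure_def)
  moreover have "emeasure lborel ?B \<noteq> \<infinity>"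
    using emeasure_bounded_finite [of ?B] by auto
  ultimately show ?thesis
    by (simp add: ennreal_mult_cancel_left mult.commute [of _ "emeasure lborel ?B"])
qed

lemma lborel_distr_orthogonal:
  fixes T :: "'a::euclidean_space \<Rightarrow> 'a"
  assumes T: "orthogonal_transformation T"
  shows "distr lborel borel T = lborel"
  using orthogonal_transformation_measurable [OF T]
  by (intro measure_eqI)
    (auto simp: emeasure_distr emeasure_lborel_orthogonal_vimage [OF T])

text \<open>\<open>lebesgue\<close> is the completion of \<open>lborel\<close>. As \<open>T\<close>
  preserves \<open>lborel\<close>, preimages of null sets are null, so measurability and invariance
  pass to the completion, where the functions in \<open>L2\<close> are measurable.\<close>

lemma
  fixes T :: "'a::euclidean_space \<Rightarrow> 'a"
  assumes T: "orthogonal_transformation T"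
  shows lebesgue_distr_orthogonal: "distr lebesgue lebesgue T = lebesgue"
    and lebesgue_orthogonal_measurable: "T \<in> lebesgue \<rightarrow>\<^sub>M lebesgue"
proof -
  have [measurable]: "T \<in> borel_measurable borel"
    by (rule orthogonal_transformation_measurable [OF T])
  have distr: "distr lebesgue lborel T = lborel"
    using lborel_distr_orthogonal [OF T] by (simp add: distr_completion cong: distr_cong)
  show "T \<in> lebesgue \<rightarrow>\<^sub>M lebesgue"
    by (simp add: completion.measurable_completion2 distr measurable_completion)
  show "distr lebesgue lebesgue T = lebesgue"
    using completion.completion_distr_eq [of T lborel lborel] by (simp add: distr measurable_completion)
qed

text \<open>This is the affine change of variables for a diagonal map with all entries equal: the
  sum over coordinates collapses to \<open>c *\<^sub>R x\<close>, the product of the entries to a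
  power.\<close>

lemma lebesgue_scaleR_translate:
  fixes b :: "'a::euclidean_space"
  assumes "c \<noteq> 0"
  shows "lebesgue = density (distr lebesgue lebesgue (\<lambda>x. b + c *\<^sub>R x)) (\<lambda>_. \<bar>c\<bar> ^ DIM('a))"
    and "(\<lambda>x. b + c *\<^sub>R x) \<in> lebesgue \<rightarrow>\<^sub>M lebesgue"
  using lebesgue_affine_euclidean [of "\<lambda>_ :: 'a. c" b] lebesgue_affine_measurable [of "\<lambda>_ :: 'a. c" b] assms
  unfolding scaleR_scaleR [symmetric] scaleR_sum_right [symmetric] euclidean_representation prod_constant
  by simp_all

lemma lebesgue_integral_scaleR_translate:
  fixes g :: "'a::euclidean_space \<Rightarrow> 'b::euclidean_space"
  assumes c: "c \<noteq> 0" and g [measurable]: "g \<in> borel_measurable lebesgue"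
  shows "(\<integral>x. g x \<partial>lebesgue) = \<bar>c\<bar> ^ DIM('a) *\<^sub>R (\<integral>x. g (b + c *\<^sub>R x) \<partial>lebesgue)"
proof -
  note [measurable] = lebesgue_scaleR_translate(2) [OF c, of b]
  have "(\<integral>x. g x \<partial>lebesgue)
      = (\<integral>x. g x \<partial>density (distr lebesgue lebesgue (\<lambda>x. b + c *\<^sub>R x)) (\<lambda>_. \<bar>c\<bar> ^ DIM('a)))"
    by (simp only: lebesgue_scaleR_translate(1) [OF c, of b, symmetric])
  also have "\<dots> = \<bar>c\<bar> ^ DIM('a) *\<^sub>R (\<integral>x. g (b + c *\<^sub>R x) \<partial>lebesgue)"
    by (subst integral_density) (simp_all add: integral_distr)
  finally show ?thesis .
qed

text \<open>By linearity the substitution is \<open>T\<close> followed by a dilation and a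
  translation; \<open>T\<close> preserves the measure and the dilation supplies the
  Jacobian.\<close>

lemma lebesgue_integral_similarity:
  fixes g :: "'a::euclidean_space \<Rightarrow> 'b::euclidean_space" and T :: "'a \<Rightarrow> 'a"
  assumes T: "orthogonal_transformation T" and c: "c > 0"
    and g [measurable]: "g \<in> borel_measurable lebesgue"
  shows "(\<integral>x. g (c *\<^sub>R T (x - b)) \<partial>lebesgue) = (1 / c ^ DIM('a)) *\<^sub>R (\<integral>x. g x \<partial>lebesgue)"
proof -
  note [measurable] = lebesgue_orthogonal_measurable [OF T]
  have lin: "linear T"
    using T by (simp add: orthogonal_transformation)
  have eq: "c *\<^sub>R T (x - b) = - (c *\<^sub>R T b) + c *\<^sub>R T x" for x
    by (simp add: linear_diff [OF lin] algebra_simps)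
  have [measurable]: "(\<lambda>x. g (- (c *\<^sub>R T b) + c *\<^sub>R x)) \<in> borel_measurable lebesgue"
    by (rule measurable_compose [OF lebesgue_scaleR_translate(2) g]) (use c in simp)
  have "(\<integral>x. g (c *\<^sub>R T (x - b)) \<partial>lebesgue)
      = (\<integral>x. g (- (c *\<^sub>R T b) + c *\<^sub>R x) \<partial>distr lebesgue lebesgue T)"
    unfolding eq by (rule integral_distr [symmetric]) measurable
  also have "\<dots> = (\<integral>x. g (- (c *\<^sub>R T b) + c *\<^sub>R x) \<partial>lebesgue)"
    by (simp only: lebesgue_distr_orthogonal [OF T])
  also have "\<dots> = (1 / c ^ DIM('a)) *\<^sub>R (\<integral>x. g x \<partial>lebesgue)"
    using c by (subst lebesgue_integral_scaleR_translate [of c g "- (c *\<^sub>R T b)"]) simp_all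
  finally show ?thesis .
qed


section \<open>Clifford-valued integrals and limits\<close>

lemma bounded_bilinear_clifford_mult:
  "bounded_bilinear ((*) :: 'n::{finite,linorder} clifford \<Rightarrow> 'n clifford \<Rightarrow> 'n clifford)"
  unfolding bilinear_conv_bounded_bilinear [symmetric] bilinear_def
  by (auto intro!: linearI simp: distrib_left distrib_right)

lemma bounded_linear_clifford_mult_left:
  "bounded_linear ((*) (a :: 'n::{finite,linorder} clifford))"
  by (rule bounded_bilinear.bounded_linear_right [OF bounded_bilinear_clifford_mult])

lemma borel_measurable_clifford_mult [measurable (raw)]:
  fixes f g :: "'a \<Rightarrow> 'n::{finite,linorder} clifford"
  assumes "f \<in> borel_measurable M" "g \<in> borel_measurable M"
  shows "(\<lambda>x. f x * g x) \<in> borel_measurable M"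
  using assms
  by (rule borel_measurable_continuous_Pair)
    (intro bounded_bilinear.continuous_on [OF bounded_bilinear_clifford_mult] continuous_intros)

text \<open>The integral of a non-integrable function is 0 by convention. Applying \<open>L'\<close>
  shows that \<open>L\<close> cannot create integrability, so in that case both sides are 0.\<close>

lemma integral_bounded_linear_invertible:
  fixes g :: "'a \<Rightarrow> 'b::euclidean_space" and L :: "'b \<Rightarrow> 'c::euclidean_space"
  assumes L: "bounded_linear L" and L': "bounded_linear L'" and inv: "\<And>x. L' (L x) = x"
  shows "(\<integral>x. L (g x) \<partial>M) = L (\<integral>x. g x \<partial>M)"
proof (cases "integrable M g")
  case True
  then show ?thesis
    by (rule integral_bounded_linear [OF L])
next
  case False
  then have "\<not> integrable M (\<lambda>x. L (g x))"
    using integrable_bounded_linear [OF L', of M "\<lambda>x. L (g x)"] by (auto simp: inv)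
  with False show ?thesis
    by (simp add: not_integrable_integral_eq linear_0 [OF bounded_linear.linear [OF L]])
qed

lemma tendsto_bounded_linear_invertible:
  assumes L: "bounded_linear L" and L': "bounded_linear L'" and inv: "\<And>x. L' (L x) = x"
  shows "((\<lambda>x. L (g x)) \<longlongrightarrow> L l) F \<longleftrightarrow> (g \<longlongrightarrow> l) F"
  using bounded_linear.tendsto [OF L, of g l F]
    bounded_linear.tendsto [OF L', of "\<lambda>x. L (g x)" "L l" F]
  by (auto simp: inv)

text \<open>Multiplication by \<open>1 / r\<close> maps the filter of right neighbourhoods of 0 to
  itself. This absorbs the rescaling of the truncation radius.\<close>

lemma tendsto_at_right_0_divide:
  fixes r :: real
  assumes "r > 0"
  shows "((\<lambda>\<epsilon>. g (\<epsilon> / r)) \<longlongrightarrow> l) (at_right 0) \<longleftrightarrow> (g \<longlongrightarrow> l) (at_right 0)"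
proof -
  have "((\<lambda>\<epsilon>. g (\<epsilon> / r)) \<longlongrightarrow> l) (at_right 0)
      \<longleftrightarrow> (g \<longlongrightarrow> l) (filtermap (times (1 / r)) (at_right 0))"
    by (simp add: filterlim_filtermap)
  then show ?thesis
    using assms by (simp add: filtermap_times_pos_at_right)
qed


section \<open>The Hilbert transformation and the representation\<close>

lemma linear_cvec: "linear cvec"
  by (rule linearI) (simp_all add: cvec_add cvec_scaleR)

text \<open>The square of a vector is the scalar minus its squared length. Squaring s x s^-1 gives s
  x^2 s^-1, and the scalar x^2 commutes with s, so lengths are preserved.\<close>

lemma orthogonal_transformation_spin:
  assumes s: "s \<in> Spin"
  shows "orthogonal_transformation (\<lambda>x. vec_part (s * cvec x * clifford_inv s))"
  unfolding orthogonal_transformation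
proof (intro conjI allI)
  show "linear (\<lambda>x. vec_part (s * cvec x * clifford_inv s))"
    by (rule linearI)
      (simp_all add: cvec_add cvec_scaleR distrib_left distrib_right vec_part_add vec_part_scaleR)
  fix x
  let ?t = "clifford_inv s" and ?y = "vec_part (s * cvec x * clifford_inv s)"
  have "(- (?y \<bullet> ?y)) *\<^sub>R 1 = cvec ?y * cvec ?y"
    by (simp only: cvec_sq)
  also have "\<dots> = s * cvec x * (?t * s) * cvec x * ?t"
    unfolding cvec_vec_part_spin [OF s] by (simp only: mult.assoc)
  also have "\<dots> = s * (cvec x * cvec x) * ?t"
    by (simp only: Spin_inv(2) [OF s] mult_1_right mult.assoc)
  also have "\<dots> = (- (x \<bullet> x)) *\<^sub>R 1"
    using Spin_inv(1) [OF s] by (simp add: cvec_sq)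
  finally have "?y \<bullet> ?y = x \<bullet> x"
    by (simp del: scaleR_minus_left)
  then show "norm ?y = norm x"
    by (simp add: norm_eq_sqrt_inner)
qed

lemma borel_measurable_hilbert_kernel [measurable]:
  "(hilbert_kernel :: (real, 'n::{finite,linorder}) vec \<Rightarrow> 'n clifford) \<in> borel_measurable borel"
proof -
  have [measurable]: "(cvec :: (real, 'n) vec \<Rightarrow> 'n clifford) \<in> borel_measurable borel"
    by (intro borel_measurable_continuous_onI linear_continuous_on)
      (simp add: linear_cvec flip: linear_conv_bounded_linear)
  show ?thesis
    unfolding hilbert_kernel_def [abs_def] by measurable
qed

text \<open>The kernel is homogeneous of degree -n: 1 from the numerator, -(n+1) from the
  denominator. It is applied with y the conjugate of x by s^-1, which is what \<open>twist\<close>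
  expresses.\<close>

lemma hilbert_kernel_similarity:
  fixes x y :: "(real, 'n::{finite,linorder}) vec"
  assumes r: "r > 0" and norm: "norm y = norm x" and twist: "s * cvec y = cvec x * s"
  shows "hilbert_kernel x * s = (1 / r ^ CARD('n)) *\<^sub>R (s * hilbert_kernel ((1 / r) *\<^sub>R y))"
  using r by (simp add: hilbert_kernel_def cvec_scaleR norm twist power_divide)

lemma truncated_hilbert_rspin_rep:
  fixes f :: "(real, 'n::{finite,linorder}) vec \<Rightarrow> 'n clifford"
  assumes r: "r > 0" and s: "s \<in> Spin" and f [measurable]: "f \<in> borel_measurable lebesgue"
  shows "truncated_hilbert \<epsilon> (rspin_rep (r, s, b) f) x
    = rspin_rep (r, s, b) (truncated_hilbert (\<epsilon> / r) f) x"
proof -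
  define t where "t = clifford_inv s"
  have t: "t \<in> Spin" "clifford_inv t = s" "s * t = 1" "t * s = 1"
    using s by (simp_all add: t_def Spin_inv clifford_inv_inv)
  \<comment> \<open>Conjugation by s^-1 is the spin action of \<open>t\<close>, since the inverse of
    \<open>t\<close> is s again.\<close>
  define R where "R v = vec_part (t * cvec v * s)" for v :: "(real, 'n) vec"
  have R: "orthogonal_transformation R"
    using orthogonal_transformation_spin [OF t(1)] by (simp add: t(2) R_def [abs_def])
  have R_diff: "R (v - w) = R v - R w" for v w
    using R by (simp add: orthogonal_transformation linear_diff)
  have R_norm: "norm (R v) = norm v" for v
    by (rule orthogonal_transformation_norm [OF R])
  have "cvec (R v) = t * cvec v * s" for v
    using cvec_vec_part_spin [OF t(1), of v] by (simp add: t(2) R_def)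
  then have "s * cvec (R v) = s * t * cvec v * s" for v
    by (simp only: mult.assoc)
  then have twist: "s * cvec (R v) = cvec v * s" for v
    by (simp add: t)
  define T where "T y = (1 / r) *\<^sub>R R (y - b)" for y
  define c where "c = r powr (- real CARD('n) / 2)"
  have rep: "rspin_rep (r, s, b) g y = c *\<^sub>R (s * g (T y))" for g y
    by (simp add: rspin_rep_def c_def T_def R_def t_def vec_part_scaleR)
  have T_diff: "T x - T y = (1 / r) *\<^sub>R R (x - y)" for y
    by (simp add: T_def scaleR_diff_right [symmetric] R_diff)
  have kernel: "hilbert_kernel (x - y) * s = (1 / r ^ CARD('n)) *\<^sub>R (s * hilbert_kernel (T x - T y))" for y
    unfolding T_diff by (rule hilbert_kernel_similarity [OF r R_norm twist])
  have dist: "\<epsilon> < norm (x - y) \<longleftrightarrow> \<epsilon> / r < norm (T x - T y)" for y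
    using r by (simp add: T_diff R_norm divide_less_cancel)
  \<comment> \<open>This is the integrand of the truncated transform of f at \<open>T x\<close> with
    radius \<epsilon> / r.\<close>
  define G where "G u = indicat_real {u. \<epsilon> / r < norm (T x - u)} u *\<^sub>R (hilbert_kernel (T x - u) * f u)" for u
  \<comment> \<open>The factor c normalises the representation; the power of r is the homogeneity
    factor of the kernel.\<close>
  define L where "L z = (c / r ^ CARD('n)) *\<^sub>R (s * z)" for z
  \<comment> \<open>Kernel and cut-off are Borel while f is Lebesgue measurable; the identity map
    carries the former to \<open>lebesgue\<close>.\<close>
  have id: "(\<lambda>u. u) \<in> lebesgue \<rightarrow>\<^sub>M borel"
    by (simp add: measurable_completion)
  have [measurable]: "(\<lambda>u. hilbert_kernel (T x - u)) \<in> borel_measurable lebesgue"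
    "(\<lambda>u. indicat_real {u. \<epsilon> / r < norm (T x - u)} u) \<in> borel_measurable lebesgue"
    by (rule measurable_compose [OF id]; measurable)+
  have G [measurable]: "G \<in> borel_measurable lebesgue"
    unfolding G_def [abs_def] by measurable
  have "bounded_linear L"
    unfolding L_def [abs_def]
    by (intro bounded_linear_compose [OF bounded_linear_scaleR_right] bounded_linear_clifford_mult_left)
  then have LG: "(\<lambda>u. L (G u)) \<in> borel_measurable lebesgue"
    by (intro measurable_compose [OF G] borel_measurable_continuous_onI linear_continuous_on)
  have integrand: "indicat_real {y. \<epsilon> < norm (x - y)} y *\<^sub>R (hilbert_kernel (x - y) * rspin_rep (r, s, b) f y)
      = L (G (T y))" for y
  proof -
    have "hilbert_kernel (x - y) * rspin_rep (r, s, b) f y = c *\<^sub>R (hilbert_kernel (x - y) * s * f (T y))"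
      by (simp only: rep mult_scaleR_right mult.assoc)
    also have "\<dots> = L (hilbert_kernel (T x - T y) * f (T y))"
      by (simp only: kernel L_def mult_scaleR_left scaleR_scaleR mult.assoc times_divide_eq_right mult_1_right)
    finally show ?thesis
      by (simp add: G_def L_def dist indicator_def)
  qed
  have "truncated_hilbert \<epsilon> (rspin_rep (r, s, b) f) x = (\<integral>y. L (G (T y)) \<partial>lebesgue)"
    by (simp only: truncated_hilbert_def set_lebesgue_integral_def integrand)
  \<comment> \<open>The map \<open>T\<close> contracts volume by r^n; the resulting factor cancels
    the denominator in \<open>L\<close>.\<close>
  also have "\<dots> = r ^ CARD('n) *\<^sub>R (\<integral>u. L (G u) \<partial>lebesgue)"
    unfolding T_def using lebesgue_integral_similarity [OF R _ LG, of "1 / r" b] r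
    by (simp add: power_divide)
  also have "(\<integral>u. L (G u) \<partial>lebesgue) = L (\<integral>u. G u \<partial>lebesgue)"
  proof (rule integral_bounded_linear_invertible)
    let ?L' = "\<lambda>z. (r ^ CARD('n) / c) *\<^sub>R (t * z)"
    show "bounded_linear L" by fact
    show "bounded_linear ?L'"
      by (intro bounded_linear_compose [OF bounded_linear_scaleR_right] bounded_linear_clifford_mult_left)
    show "?L' (L z) = z" for z
      using r by (simp add: L_def c_def t(4) mult.assoc [symmetric])
  qed
  also have "r ^ CARD('n) *\<^sub>R \<dots> = rspin_rep (r, s, b) (truncated_hilbert (\<epsilon> / r) f) x"
    using r by (simp add: L_def rep truncated_hilbert_def set_lebesgue_integral_def G_def)
  finally show ?thesis .
qed

text \<open>The truncated identity is passed to the limit. The action \<open>L\<close> on values is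
  invertible and continuous both ways, so principal values at x and at the transformed point y exist
  together and both branches of \<open>hilbert\<close> match.\<close>

lemma hilbert_rspin_rep:
  fixes f :: "(real, 'n::{finite,linorder}) vec \<Rightarrow> 'n clifford"
  assumes r: "r > 0" and s: "s \<in> Spin" and f: "f \<in> borel_measurable lebesgue"
  shows "hilbert (rspin_rep (r, s, b) f) x = rspin_rep (r, s, b) (hilbert f) x"
proof -
  define y where "y = vec_part ((1 / r) *\<^sub>R (clifford_inv s * cvec (x - b) * s))"
  define c where "c = r powr (- real CARD('n) / 2)"
  define L where "L z = c *\<^sub>R (s * z)" for z
  define L' where "L' z = (1 / c) *\<^sub>R (clifford_inv s * z)" for z
  have rep: "rspin_rep (r, s, b) g x = L (g y)" for g
    by (simp add: rspin_rep_def L_def c_def y_def)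
  have c: "c \<noteq> 0"
    using r by (simp add: c_def)
  have lin: "bounded_linear L" "bounded_linear L'"
    unfolding L_def [abs_def] L'_def [abs_def]
    by (intro bounded_linear_compose [OF bounded_linear_scaleR_right] bounded_linear_clifford_mult_left)+
  have inv: "L' (L z) = z" "L (L' z) = z" for z
    using c by (simp_all add: L_def L'_def Spin_inv [OF s] mult.assoc [symmetric])
  have trunc: "truncated_hilbert \<epsilon> (rspin_rep (r, s, b) f) x = L (truncated_hilbert (\<epsilon> / r) f y)" for \<epsilon>
    by (simp only: truncated_hilbert_rspin_rep [OF r s f] rep)
  have lim: "((\<lambda>\<epsilon>. truncated_hilbert \<epsilon> (rspin_rep (r, s, b) f) x) \<longlongrightarrow> L l) (at_right 0)
      \<longleftrightarrow> ((\<lambda>\<epsilon>. truncated_hilbert \<epsilon> f y) \<longlongrightarrow> l) (at_right 0)" for l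
    unfolding trunc tendsto_bounded_linear_invertible [OF lin inv(1)]
    by (rule tendsto_at_right_0_divide [OF r])
  show ?thesis
  proof (cases "\<exists>l. ((\<lambda>\<epsilon>. truncated_hilbert \<epsilon> f y) \<longlongrightarrow> l) (at_right 0)")
    case True
    then obtain l where l: "((\<lambda>\<epsilon>. truncated_hilbert \<epsilon> f y) \<longlongrightarrow> l) (at_right 0)"
      by blast
    \<comment> \<open>Uniqueness of limits identifies \<open>Lim\<close> with any limit at
      hand.\<close>
    have eq: "hilbert g z = hilbert_const CARD('n) *\<^sub>R m"
      if "((\<lambda>\<epsilon>. truncated_hilbert \<epsilon> g z) \<longlongrightarrow> m) (at_right 0)"
      for g :: "(real, 'n) vec \<Rightarrow> 'n clifford" and z m
      using that tendsto_Lim [OF _ that] by (auto simp: hilbert_def)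
    show ?thesis
      unfolding rep eq [OF l] eq [OF lim [THEN iffD2, OF l]] by (simp add: L_def mult.commute)
  next
    case False
    \<comment> \<open>Every l equals \<open>L (L' l)\<close>, so a limit for the transformed
      function would yield the limit \<open>L' l\<close> for f at y.\<close>
    then have "\<nexists>l. ((\<lambda>\<epsilon>. truncated_hilbert \<epsilon> (rspin_rep (r, s, b) f) x) \<longlongrightarrow> l) (at_right 0)"
      using lim by (metis inv(2))
    \<comment> \<open>Both transforms take the default value 0, which \<open>L\<close>
      fixes.\<close>
    with False show ?thesis
      unfolding rep by (simp add: hilbert_def L_def)
  qed
qed

theorem proposition2p2:
  fixes f :: "(real, 'n::{finite,linorder}) vec \<Rightarrow> 'n clifford"
    and r :: real and s :: "'n clifford" and b :: "(real, 'n) vec"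
  assumes "(r, s, b) \<in> carrier rspin_group"
    and "f \<in> L2"
  shows "AE x in lebesgue.
    hilbert (rspin_rep (r, s, b) f) x = rspin_rep (r, s, b) (hilbert f) x"
proof (intro AE_I2 hilbert_rspin_rep)
  show "r > 0" "s \<in> Spin"
    using assms(1) by (simp_all add: rspin_group_def)
  show "f \<in> borel_measurable lebesgue"
    using assms(2) by (simp add: L2_def)
qed

end
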